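(* Let $N\ge2$ and let $D_j\subset\mathbb{R}^n$, $1\le j\le N$, be compact domains with $|\partial D_1|=0$ (Lebesgue measure). Let $c\in C^1(D_1\times\cdots\times D_N)$ be a Lipschitz real-valued function, and suppose that for each $x_1\in D_1$ the map $$(x_2,\dots,x_N)\mapsto\nabla_{x_1}c(x_1,x_2,\dots,x_N)$$ from $D_2\times\cdots\times D_N$ to $\mathbb{R}^n$ is injective. Then $c$ satisfies the single-valued condition Lebesgue a.e.: for each $c$-conjugate $(f_1,\dots,f_N)\in C(D_1)\times\cdots\times C(D_N)$, the set $\partial_cf_1(x_1)$ is a singleton for Lebesgue-a.e. $x_1\in D_1$.
   Context: A compact domain is the closure of a nonempty bounded connected open set. Lipschitz means: there is $K>0$ with $|c(x_1,\dots,x_N)-c(y_1,\dots,y_N)|\le K\,(|x_1-y_1|+\cdots+|x_N-y_N|)$ for all $x_i,y_i\in D_i$. $c$-transform: for $F=(f_1,\dots,f_N)\in C(D_1)\times\cdots\times C(D_N)$ (real-valued continuous functions), the $j$-th $c$-transform of $F$ is $$f_j^c(x_j)=\inf_{z_k\in D_k,\,k\ne j}\Big\{c(z_1,\dots,z_{j-1},x_j,z_{j+1},\dots,z_N)-\sum_{k\ne j}f_k(z_k)\Big\}.$$ The vector $(f_1,\dots,f_N)$ is $c$-conjugate if $f_j=f_j^c$ for all $1\le j\le N$. $c$-normal mapping: for $(f_1,\dots,f_N)$ $c$-conjugate, $$\partial_cf_1(x_1)=\{(z_2,\dots,z_N)\in D_2\times\cdots\times D_N: f_1(x_1)+f_2(z_2)+\cdots+f_N(z_N)=c(x_1,z_2,\dots,z_N)\}.$$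 *)

theory Defs
  imports "HOL-Analysis.Analysis"
begin

text \<open>
  The indices $1,\dots,N$ are the elements of a finite type \<open>'k\<close>, so that $N$ is \<open>CARD('k)\<close> and
  $(\mathbb{R}^n)^N$ is the Euclidean space \<open>(real^'n)^'k\<close>. The index called $1$ in the mathematics
  is an explicit parameter \<open>p\<close>. A tuple that omits the \<open>j\<close>-th entry is an
  extensional function on \<open>- {j}\<close>, that is, an element of \<open>PiE (- {j}) D\<close>.
\<close>

definition compact_domain :: "'a::euclidean_space set \<Rightarrow> bool" where
  "compact_domain D \<longleftrightarrow>
     (\<exists>U. U \<noteq> {} \<and> bounded U \<and> connected U \<and> open U \<and> D = closure U)"

definition vec_prod :: "('k::finite \<Rightarrow> 'a set) \<Rightarrow> ('a^'k) set" where
  "vec_prod D = {x. \<forall>i. x $ i \<in> D i}"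

definition others :: "('k \<Rightarrow> 'a set) \<Rightarrow> 'k \<Rightarrow> ('k \<Rightarrow> 'a) set" where
  "others D j = PiE (- {j}) D"

definition insert_at :: "'k::finite \<Rightarrow> 'a \<Rightarrow> ('k \<Rightarrow> 'a) \<Rightarrow> 'a^'k" where
  "insert_at j x z = (\<chi> i. if i = j then x else z i)"

definition lipschitz_cost ::
    "('k::finite \<Rightarrow> (real^'n) set) \<Rightarrow> ((real^'n)^'k \<Rightarrow> real) \<Rightarrow> bool" where
  "lipschitz_cost D c \<longleftrightarrow>
     (\<exists>K>0. \<forall>x\<in>vec_prod D. \<forall>y\<in>vec_prod D. \<bar>c x - c y\<bar> \<le> K * (\<Sum>i\<in>UNIV. norm (x $ i - y $ i)))"

text \<open>
  \<open>f\<close> is $C^1$ on the closure \<open>S\<close> of an open set, with gradient \<open>G\<close>: \<open>f\<close> is continuous on \<open>S\<close>,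
  differentiable in the interior, and its gradient there extends continuously to \<open>S\<close>. At boundary
  points \<open>G\<close> is this extension. A derivative \<open>at x within S\<close> could fail to be unique there
  (for instance at a cusp), whereas \<open>G\<close> is determined on \<open>S\<close> by \<open>f\<close>, as the lemma below shows.
  For \<open>f\<close> on \<open>(real^'n)^'k\<close>, the partial gradient $\nabla_{x_i} f$ is \<open>G x $ i\<close>, because the inner
  product of that space is the sum of the inner products of the components.
\<close>
definition C1_with_gradient ::
    "'a::euclidean_space set \<Rightarrow> ('a \<Rightarrow> real) \<Rightarrow> ('a \<Rightarrow> 'a) \<Rightarrow> bool" where
  "C1_with_gradient S f G \<longleftrightarrow>
     continuous_on S f \<and> continuous_on S G \<and> (\<forall>x\<in>interior S. GDERIV f x :> G x)"

lemma C1_with_gradient_unique: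
  assumes "C1_with_gradient S f G" "C1_with_gradient S f H"
    and U: "open U" and S: "S = closure U" and x: "x \<in> S"
  shows "G x = H x"
proof -
  have eq: "G y - H y = 0" if "y \<in> U" for y
  proof -
    have "y \<in> interior S"
      using that U S by (meson closure_subset interior_maximal subsetD)
    then have "(\<lambda>h. h \<bullet> G y) = (\<lambda>h. h \<bullet> H y)"
      using assms(1,2) unfolding C1_with_gradient_def gderiv_def
      by (blast intro: has_derivative_unique)
    then show ?thesis using vector_eq_ldot[of "G y" "H y"] by (simp add: fun_eq_iff)
  qed
  have "continuous_on (closure U) (\<lambda>y. G y - H y)"
    using assms(1,2) S unfolding C1_with_gradient_def by (metis continuous_on_diff)
  from continuous_constant_on_closure[OF this eq] x S show ?thesis by simp
qed

definition c_transform ::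
    "('k::finite \<Rightarrow> (real^'n) set) \<Rightarrow> ((real^'n)^'k \<Rightarrow> real) \<Rightarrow> ('k \<Rightarrow> real^'n \<Rightarrow> real)
      \<Rightarrow> 'k \<Rightarrow> real^'n \<Rightarrow> real" where
  "c_transform D c f j x = (INF z\<in>others D j. c (insert_at j x z) - (\<Sum>k\<in>- {j}. f k (z k)))"

definition c_conjugate ::
    "('k::finite \<Rightarrow> (real^'n) set) \<Rightarrow> ((real^'n)^'k \<Rightarrow> real) \<Rightarrow> ('k \<Rightarrow> real^'n \<Rightarrow> real) \<Rightarrow> bool" where
  "c_conjugate D c f \<longleftrightarrow> (\<forall>j. \<forall>x\<in>D j. f j x = c_transform D c f j x)"

definition c_normal ::
    "('k::finite \<Rightarrow> (real^'n) set) \<Rightarrow> ((real^'n)^'k \<Rightarrow> real) \<Rightarrow> 'k \<Rightarrow> ('k \<Rightarrow> real^'n \<Rightarrow> real)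
      \<Rightarrow> real^'n \<Rightarrow> ('k \<Rightarrow> real^'n) set" where
  "c_normal D c p f x =
     {z \<in> others D p. f p x + (\<Sum>k\<in>- {p}. f k (z k)) = c (insert_at p x z)}"

definition single_valued_ae ::
    "('k::finite \<Rightarrow> (real^'n) set) \<Rightarrow> ((real^'n)^'k \<Rightarrow> real) \<Rightarrow> 'k \<Rightarrow> bool" where
  "single_valued_ae D c p \<longleftrightarrow>
     (\<forall>f. (\<forall>j. continuous_on (D j) (f j)) \<and> c_conjugate D c f \<longrightarrow>
        (AE x in lebesgue. x \<in> D p \<longrightarrow> is_singleton (c_normal D c p f x)))"

end

theory Submission
  imports Defs
begin

text \<open>
  Write $\<Gamma>$ for the set of tuples \<open>w\<close> in $\prod_j D_j$ with $\sum_k f_k(w_k) = c(w)$. Conjugacy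
  says that $\sum_k f_k(w_k) \le c(w)$ on the whole product, with equality for at least one
  \<open>w\<close> over each $x \in D_p$; by compactness the infimum is attained
  (\<open>c_transform_contact\<close>). So the values of the $c$-normal mapping at \<open>x\<close> are nonempty, and they
  are the fibres of the compact set $\<Gamma>$ over \<open>x\<close>.

  Suppose that two tuples \<open>w\<close>, \<open>w'\<close> of $\<Gamma>$ lie over the same interior point \<open>x\<close>. On the line
  through \<open>x\<close> in a direction \<open>v\<close>, the function $f_p$ is touched from above at \<open>x\<close> by two
  differentiable functions, whose slopes there are $\nabla_{x_p} c(w) \cdot v$ and
  $\nabla_{x_p} c(w') \cdot v$. If the first slope is smaller, pick a rational \<open>q\<close> strictly
  between the two. To the right of \<open>x\<close> the first function keeps $f_p$ below the
  line of slope \<open>q\<close>, to the left the second one does, so \<open>x\<close> is a strict local maximum of $f_p$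
  minus that line (\<open>contact_kink_strict_local_max\<close>). A real function has only countably many
  strict local maxima, and there are countably many \<open>q\<close>, so every line in direction \<open>v\<close> contains
  only countably many such points. Fubini's theorem then makes the set of all of them null
  (\<open>slope_gap_set_null\<close>); it is Borel because it is a countable union of projections of
  compact sets, intersected with the interior of $D_p$.

  Outside these null sets, taken for the coordinate directions, and outside the null boundary of
  $D_p$, all tuples of $\<Gamma>$ over \<open>x\<close> have the same gradient in $x_p$, and injectivity of that
  gradient leaves only one of them.

  One point needs care: in a contact tuple the other components may be boundary points, where \<open>G\<close>
  is merely the continuous extension of the gradient. The slope
  estimate is therefore obtained from the mean value theorem at nearby interior tuples, by a
  limit (\<open>C1_with_gradient_slope_less\<close>).
\<close>

section \<open>Strict local maxima and sets that lines meet in countably many points\<close>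

text \<open>
  A neighbourhood taken from a countable basis can witness the strict maximality of one point
  only: two points with the same witness would each have the larger value.
\<close>

lemma countable_strict_local_maxima:
  fixes g :: "'a::second_countable_topology \<Rightarrow> 'b::order"
  shows "countable {t. \<exists>V. open V \<and> t \<in> V \<and> (\<forall>s\<in>V - {t}. g s < g t)}" (is "countable ?M")
proof -
  obtain B :: "'a set set" where B: "countable B" "topological_basis B"
    using ex_countable_basis by blast
  have "\<exists>V\<in>B. t \<in> V \<and> (\<forall>s\<in>V - {t}. g s < g t)" if "t \<in> ?M" for t
  proof -
    from that obtain V where V: "open V" "t \<in> V" "\<forall>s\<in>V - {t}. g s < g t" by blast
    then obtain V' where "V' \<in> B" "t \<in> V'" "V' \<subseteq> V"
      using topological_basisE[OF B(2)] by metis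
    with V(3) show ?thesis by blast
  qed
  then have "\<forall>t\<in>?M. \<exists>V. V \<in> B \<and> t \<in> V \<and> (\<forall>s\<in>V - {t}. g s < g t)" by blast
  from bchoice[OF this] obtain h where
    h: "\<And>t. t \<in> ?M \<Longrightarrow> h t \<in> B \<and> t \<in> h t \<and> (\<forall>s\<in>h t - {t}. g s < g t)"
    by blast
  have "inj_on h ?M"
  proof (rule inj_onI, rule ccontr)
    fix s t assume st: "s \<in> ?M" "t \<in> ?M" "h s = h t" "s \<noteq> t"
    then have "g s < g t" "g t < g s"
      using h[OF st(1)] h[OF st(2)] by auto
    then show False by (meson less_asym)
  qed
  moreover have "countable (h ` ?M)"
    using h B(1) by (meson countable_subset image_subsetI)
  ultimately show ?thesis by (simp add: countable_image_inj_eq)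
qed

text \<open>
  All translates of \<open>S\<close> by \<open>t *\<^sub>R v\<close> have the measure of \<open>S\<close>, so averaging them over \<open>t\<close> in
  $[0,1]$ returns this measure. In the other order of integration the inner integral runs over a
  countable set of parameters \<open>t\<close> and vanishes. Averaging over translates permits any direction
  \<open>v\<close> and avoids splitting the space into a line and a complement.
\<close>

lemma null_set_if_countable_on_parallel_lines:
  fixes S :: "'a::euclidean_space set"
  assumes S: "S \<in> sets borel" and lines: "\<And>x. countable {t. x + t *\<^sub>R v \<in> S}"
  shows "S \<in> null_sets lborel"
proof -
  have [measurable]: "S \<in> sets borel" by fact
  have translate: "(\<integral>\<^sup>+x. indicator S (x + t *\<^sub>R v) \<partial>lborel) = emeasure lborel S" for t :: real
  proof -
    have "emeasure lborel S = (\<integral>\<^sup>+x. indicator S x \<partial>distr lborel borel ((+) (t *\<^sub>R v)))"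
      by (simp add: lborel_distr_plus)
    also have "\<dots> = (\<integral>\<^sup>+x. indicator S (t *\<^sub>R v + x) \<partial>lborel)"
      by (subst nn_integral_distr) auto
    finally show ?thesis by (simp add: add.commute)
  qed
  have "emeasure lborel S = (\<integral>\<^sup>+t\<in>{0..1::real}. emeasure lborel S \<partial>lborel)"
    by (simp add: nn_integral_cmult_indicator)
  also have "\<dots> = (\<integral>\<^sup>+t. (\<integral>\<^sup>+x. indicator S (x + t *\<^sub>R v) * indicator {0..1::real} t \<partial>lborel) \<partial>lborel)"
    by (subst nn_integral_multc) (auto simp: translate)
  also have "\<dots> = (\<integral>\<^sup>+x. (\<integral>\<^sup>+t. indicator S (x + t *\<^sub>R v) * indicator {0..1::real} t \<partial>lborel) \<partial>lborel)"
    by (rule lborel_pair.Fubini') measurable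
  also have "\<dots> = (\<integral>\<^sup>+x. 0 \<partial>(lborel :: 'a measure))"
  proof (rule nn_integral_cong)
    fix x :: 'a
    have "{t. x + t *\<^sub>R v \<in> S} \<in> null_sets lborel"
      using lines by (rule countable_imp_null_set_lborel)
    then have "AE t in lborel. t \<notin> {t. x + t *\<^sub>R v \<in> S}" by (rule AE_not_in)
    then have "AE t in lborel. indicator S (x + t *\<^sub>R v) * indicator {0..1::real} t = (0::ennreal)"
      by eventually_elim simp
    then show "(\<integral>\<^sup>+t. indicator S (x + t *\<^sub>R v) * indicator {0..1::real} t \<partial>lborel) = 0"
      by (subst nn_integral_0_iff_AE) auto
  qed
  finally show ?thesis by (simp add: null_sets_def S)
qed

section \<open>One-sided slopes of a C1 function at boundary points\<close>

text \<open>
  The point \<open>w\<close> may lie on the boundary of \<open>S\<close>, where \<open>G w\<close> is not a derivative of \<open>c\<close>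
  by definition but a limit of gradients. By continuity
  of \<open>G\<close> the slope in direction \<open>u\<close> stays below some \<open>q' < q\<close> near \<open>w\<close>; the mean value theorem
  turns this into a bound on increments of \<open>c\<close> that start in the open set \<open>W\<close>, and the bound
  passes to the limit at \<open>w\<close>. The set \<open>W\<close> is a part of the interior of \<open>S\<close> that is not left by
  short steps along \<open>u\<close>; in a product of domains this holds when \<open>u\<close> moves
  only a component that lies in the interior of its domain.
\<close>

lemma C1_with_gradient_slope_less:
  fixes S W :: "'a::euclidean_space set"
  assumes C1: "C1_with_gradient S c G" and S: "closed S"
    and W: "open W" "W \<subseteq> S" "w \<in> closure W"
    and r: "r > 0" and stay: "\<And>y s. y \<in> W \<Longrightarrow> dist y w < r \<Longrightarrow> 0 \<le> s \<Longrightarrow> s < r \<Longrightarrow> y + s *\<^sub>R u \<in> W"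
    and slope: "G w \<bullet> u < q"
  shows "\<exists>d>0. \<forall>s. 0 < s \<and> s < d \<longrightarrow> w + s *\<^sub>R u \<in> S \<and> c (w + s *\<^sub>R u) - c w < q * s"
proof -
  have contc: "continuous_on S c" and contG: "continuous_on S G"
    and der: "\<And>x. x \<in> interior S \<Longrightarrow> GDERIV c x :> G x"
    using C1 by (auto simp: C1_with_gradient_def)
  have WS: "W \<subseteq> interior S" using W by (simp add: interior_maximal)
  have wS: "w \<in> S" using W S by (meson closure_minimal subsetD)
  \<comment> \<open>The limit below turns \<open><\<close> into \<open>\<le>\<close>; the room between \<open>q'\<close> and \<open>q\<close> restores strictness.\<close>
  obtain q' where q': "G w \<bullet> u < q'" "q' < q" using slope dense by blast
  have "continuous_on S (\<lambda>y. G y \<bullet> u)" by (intro continuous_intros contG)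
  then have "((\<lambda>y. G y \<bullet> u) \<longlongrightarrow> G w \<bullet> u) (at w within S)"
    using wS by (auto simp: continuous_on_def)
  then have "\<forall>\<^sub>F y in at w within S. G y \<bullet> u < q'"
    using q'(1) by (rule order_tendstoD(2))
  then obtain e where e: "e > 0" and e_slope: "\<forall>y\<in>S. y \<noteq> w \<and> dist y w < e \<longrightarrow> G y \<bullet> u < q'"
    unfolding eventually_at by blast
  have Gq: "G y \<bullet> u < q'" if "y \<in> S" "dist y w < e" for y
    using e_slope q'(1) that by (cases "y = w") auto
  \<comment> \<open>A step of length \<open>s < d\<close> uses at most \<open>e / 2\<close> of the distance, the start point the rest.\<close>
  define d where "d = min r (e / (2 * (norm u + 1)))"
  have pos: "0 < norm u + 1" using norm_ge_zero[of u] by linarith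
  have d: "d > 0" using r e pos by (simp add: d_def)
  have bound: "w + s *\<^sub>R u \<in> S \<and> c (w + s *\<^sub>R u) - c w \<le> q' * s" if s: "0 < s" "s < d" for s
  proof -
    obtain X where X: "\<And>n. X n \<in> W" "X \<longlonglongrightarrow> w"
      using W(3) by (auto simp: closure_sequential)
    have sr: "s < r" and su: "s * norm u < e / 2"
    proof -
      show "s < r" using s by (simp add: d_def)
      have "s < e / (2 * (norm u + 1))" using s by (simp add: d_def)
      then have "s * (2 * (norm u + 1)) < e"
        using pos by (subst (asm) pos_less_divide_eq) auto
      then have "2 * (s * norm u) + 2 * s < e" by (simp add: algebra_simps)
      then show "s * norm u < e / 2" using s by linarith
    qed
    have near: "y + s *\<^sub>R u \<in> S \<and> c (y + s *\<^sub>R u) - c y \<le> q' * s"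
      if y: "y \<in> W" "dist y w < min r (e / 2)" for y
    proof -
      have inW: "y + t *\<^sub>R u \<in> W" if "0 \<le> t" "t \<le> s" for t
        using stay[of y t] y that sr by simp
      have dc: "((\<lambda>t. c (y + t *\<^sub>R u)) has_real_derivative (G (y + t *\<^sub>R u) \<bullet> u)) (at t)"
        if "0 \<le> t" "t \<le> s" for t
      proof -
        have "(c has_derivative (\<lambda>h. h \<bullet> G (y + t *\<^sub>R u))) (at (y + t *\<^sub>R u))"
          using der inW[OF that] WS unfolding gderiv_def by blast
        moreover have "((\<lambda>t. y + t *\<^sub>R u) has_derivative (\<lambda>h. h *\<^sub>R u)) (at t)"
          by (auto intro!: derivative_eq_intros)
        ultimately have "((\<lambda>t. c (y + t *\<^sub>R u)) has_derivative (\<lambda>h. (h *\<^sub>R u) \<bullet> G (y + t *\<^sub>R u))) (at t)"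
          using has_derivative_compose by blast
        then show ?thesis
          by (simp add: has_field_derivative_def inner_commute mult.commute[of _ "_ \<bullet> _"])
      qed
      from MVT2[OF s(1) dc] obtain t where t: "0 < t" "t < s"
        "c (y + s *\<^sub>R u) - c (y + 0 *\<^sub>R u) = (s - 0) * (G (y + t *\<^sub>R u) \<bullet> u)" by blast
      have "dist (y + t *\<^sub>R u) w \<le> dist y w + t * norm u"
        using t norm_triangle_ineq[of "y - w" "t *\<^sub>R u"] by (simp add: dist_norm algebra_simps)
      also have "t * norm u \<le> s * norm u" using t by (intro mult_right_mono) auto
      finally have "dist (y + t *\<^sub>R u) w < e" using su y by simp
      then have "G (y + t *\<^sub>R u) \<bullet> u < q'"
        using Gq inW[of t] t W(2) by auto
      then have "s * (G (y + t *\<^sub>R u) \<bullet> u) \<le> s * q'" using s by simp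
      then show ?thesis using t inW[of s] s W(2) by (auto simp: mult.commute)
    qed
    have ev: "\<forall>\<^sub>F n in sequentially. X n + s *\<^sub>R u \<in> S \<and> c (X n + s *\<^sub>R u) - c (X n) \<le> q' * s"
    proof -
      have "\<forall>\<^sub>F n in sequentially. dist (X n) w < min r (e / 2)"
        using X(2) r e by (intro tendstoD) auto
      then show ?thesis by eventually_elim (use near X in blast)
    qed
    have limu: "(\<lambda>n. X n + s *\<^sub>R u) \<longlonglongrightarrow> w + s *\<^sub>R u"
      by (intro tendsto_intros X)
    have ws: "w + s *\<^sub>R u \<in> S"
      by (rule Lim_in_closed_set[OF S _ _ limu]) (use ev in \<open>auto elim: eventually_mono\<close>)
    have "(\<lambda>n. c (X n + s *\<^sub>R u)) \<longlonglongrightarrow> c (w + s *\<^sub>R u)"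
      by (rule continuous_on_tendsto_compose[OF contc limu ws])
        (use ev in \<open>auto elim: eventually_mono\<close>)
    moreover have "(\<lambda>n. c (X n)) \<longlonglongrightarrow> c w"
    proof -
      have "\<forall>\<^sub>F n in sequentially. X n \<in> S" using X(1) W(2) by (simp add: subset_iff)
      then show ?thesis by (rule continuous_on_tendsto_compose[OF contc X(2) wS])
    qed
    ultimately have "(\<lambda>n. c (X n + s *\<^sub>R u) - c (X n)) \<longlonglongrightarrow> c (w + s *\<^sub>R u) - c w"
      by (rule tendsto_diff)
    then have "c (w + s *\<^sub>R u) - c w \<le> q' * s"
      by (rule tendsto_upperbound) (use ev in \<open>auto elim: eventually_mono\<close>)
    with ws show ?thesis by blast
  qed
  have "c (w + s *\<^sub>R u) - c w < q * s" if "0 < s" "s < d" for s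
    using bound[OF that] mult_strict_right_mono[OF q'(2) that(1)] by linarith
  with bound d show ?thesis by blast
qed

section \<open>Products of domains\<close>

lemma compact_domainD:
  assumes "compact_domain D"
  shows "compact D" "D \<noteq> {}" "D = closure (interior D)"
proof -
  obtain U where U: "U \<noteq> {}" "bounded U" "open U" "D = closure U"
    using assms by (auto simp: compact_domain_def)
  then show "compact D" by (simp add: compact_closure)
  show "D \<noteq> {}" using U by simp
  have "U \<subseteq> interior D" using U by (simp add: closure_subset interior_maximal)
  then have "D \<subseteq> closure (interior D)" unfolding U(4) by (rule closure_mono)
  moreover have "closure (interior D) \<subseteq> D"
    using U by (simp add: closure_minimal interior_subset)
  ultimately show "D = closure (interior D)" by blast
qed

lemma compact_vec_prod:
  fixes D :: "'k::finite \<Rightarrow> 'a::euclidean_space set"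
  assumes "\<And>i. compact (D i)"
  shows "compact (vec_prod D)"
proof -
  have "closed (vec_prod D)"
    unfolding vec_prod_def using assms compact_imp_closed by (intro closed_vector_box) blast
  moreover have "bounded (vec_prod D)"
  proof -
    have "\<forall>i. \<exists>b. \<forall>x\<in>D i. norm x \<le> b"
      using assms compact_imp_bounded by (auto simp: bounded_iff[symmetric])
    then obtain b where b: "\<And>i x. x \<in> D i \<Longrightarrow> norm x \<le> b i" by metis
    have "norm w \<le> (\<Sum>i\<in>UNIV. b i)" if "w \<in> vec_prod D" for w
    proof -
      have "norm w \<le> (\<Sum>i\<in>UNIV. norm (w $ i))"
        unfolding norm_vec_def by (rule L2_set_le_sum) simp
      also have "\<dots> \<le> (\<Sum>i\<in>UNIV. b i)"
        using that b by (intro sum_mono) (auto simp: vec_prod_def)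
      finally show ?thesis .
    qed
    then show ?thesis by (auto simp: bounded_iff)
  qed
  ultimately show ?thesis by (simp add: compact_eq_bounded_closed)
qed

lemma vec_prod_subset_closure_interiors:
  fixes D :: "'k::finite \<Rightarrow> 'a::real_normed_vector set"
  assumes "\<And>i. D i \<subseteq> closure (interior (D i))"
  shows "vec_prod D \<subseteq> closure (vec_prod (\<lambda>i. interior (D i)))"
proof
  fix w assume "w \<in> vec_prod D"
  then have "\<forall>i. \<exists>X. (\<forall>n. X n \<in> interior (D i)) \<and> X \<longlonglongrightarrow> w $ i"
    using assms by (auto simp: vec_prod_def closure_sequential[symmetric])
  then obtain X where X: "\<And>i n. X i n \<in> interior (D i)" "\<And>i. X i \<longlonglongrightarrow> w $ i" by metis
  have "(\<lambda>n. \<chi> i. X i n) \<longlonglongrightarrow> (\<chi> i. w $ i)"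
    by (intro tendsto_vec_lambda X)
  then show "w \<in> closure (vec_prod (\<lambda>i. interior (D i)))"
    unfolding closure_sequential
    by (intro exI[of _ "\<lambda>n. \<chi> i. X i n"]) (simp add: vec_prod_def X)
qed

lemma insert_at_restrict [simp]: "insert_at p (w $ p) (restrict (($) w) (- {p})) = w"
  by (simp add: insert_at_def vec_eq_iff)

lemma insert_at_nth_same [simp]: "insert_at p x z $ p = x"
  by (simp add: insert_at_def)

lemma insert_at_nth_other: "k \<noteq> p \<Longrightarrow> insert_at p x z $ k = z k"
  by (simp add: insert_at_def)

lemma insert_at_in_vec_prod: "x \<in> D p \<Longrightarrow> z \<in> others D p \<Longrightarrow> insert_at p x z \<in> vec_prod D"
  by (auto simp: insert_at_def vec_prod_def others_def PiE_def)

lemma restrict_in_others: "w \<in> vec_prod D \<Longrightarrow> restrict (($) w) (- {p}) \<in> others D p"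
  by (auto simp: vec_prod_def others_def)

section \<open>The contact set\<close>

text \<open>
  The graph of the $c$-normal mapping, seen as a set of full tuples. In this form it does not
  prefer an index, and it is a subset of a Euclidean space, where compactness is available.
\<close>

definition contact_set ::
    "('k::finite \<Rightarrow> (real^'n) set) \<Rightarrow> ((real^'n)^'k \<Rightarrow> real) \<Rightarrow> ('k \<Rightarrow> real^'n \<Rightarrow> real)
      \<Rightarrow> ((real^'n)^'k) set" where
  "contact_set D c f = {w \<in> vec_prod D. (\<Sum>k\<in>UNIV. f k (w $ k)) = c w}"

lemma sum_insert_at:
  fixes f :: "'k::finite \<Rightarrow> 'a \<Rightarrow> real"
  shows "(\<Sum>k\<in>UNIV. f k (insert_at p x z $ k)) = f p x + (\<Sum>k\<in>- {p}. f k (z k))"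
proof -
  have "(\<Sum>k\<in>UNIV. f k (insert_at p x z $ k)) =
      f p x + (\<Sum>k\<in>UNIV - {p}. f k (insert_at p x z $ k))"
    by (subst sum.remove[of UNIV p]) auto
  also have "(\<Sum>k\<in>UNIV - {p}. f k (insert_at p x z $ k)) = (\<Sum>k\<in>- {p}. f k (z k))"
    by (intro sum.cong) (auto simp: insert_at_nth_other)
  finally show ?thesis .
qed

lemma c_normal_iff_contact:
  assumes "x \<in> D p"
  shows "z \<in> c_normal D c p f x \<longleftrightarrow> z \<in> others D p \<and> insert_at p x z \<in> contact_set D c f"
  using assms by (auto simp: c_normal_def contact_set_def sum_insert_at insert_at_in_vec_prod)

lemma continuous_on_vec_prod_sum:
  fixes D :: "'k::finite \<Rightarrow> 'a::topological_space set" and f :: "'k \<Rightarrow> 'a \<Rightarrow> real"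
  assumes "\<And>j. continuous_on (D j) (f j)"
  shows "continuous_on (vec_prod D) (\<lambda>w. \<Sum>k\<in>UNIV. f k (w $ k))"
proof (intro continuous_intros)
  fix k
  have "continuous_on (vec_prod D) (\<lambda>w. w $ k)" by (intro continuous_intros)
  then show "continuous_on (vec_prod D) (\<lambda>w. f k (w $ k))"
    by (rule continuous_on_compose2[OF assms[of k]]) (auto simp: vec_prod_def)
qed

lemma compact_contact_set:
  assumes "\<And>j. compact (D j)" "continuous_on (vec_prod D) c" "\<And>j. continuous_on (D j) (f j)"
  shows "compact (contact_set D c f)"
proof -
  note K = compact_vec_prod[of D, OF assms(1)]
  have "closed {w \<in> vec_prod D. c w - (\<Sum>k\<in>UNIV. f k (w $ k)) \<in> {0}}"
    using K continuous_on_vec_prod_sum[of D f, OF assms(3)] assms(2)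
    by (intro continuous_closed_preimage[unfolded vimage_def Int_def mem_Collect_eq]
        continuous_on_diff compact_imp_closed) auto
  moreover have "{w \<in> vec_prod D. c w - (\<Sum>k\<in>UNIV. f k (w $ k)) \<in> {0}} = contact_set D c f"
    by (auto simp: contact_set_def)
  ultimately show ?thesis
    using K by (metis (no_types, lifting) compact_Int_closed contact_set_def inf.absorb2 mem_Collect_eq subsetI)
qed

text \<open>
  Tuples that omit the entry \<open>p\<close> correspond to the full tuples with a prescribed entry \<open>p\<close>, and
  these form a compact set. So the infimum in the $c$-transform is a minimum: it bounds the sum
  of the potentials by the cost, and the minimizer is a contact tuple.
\<close>

lemma c_transform_contact:
  fixes D :: "'k::finite \<Rightarrow> (real^'n) set"
  assumes K: "\<And>j. compact (D j)" "\<And>j. D j \<noteq> {}" and c: "continuous_on (vec_prod D) c"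
    and f: "\<And>j. continuous_on (D j) (f j)"
    and conj: "\<And>x. x \<in> D p \<Longrightarrow> f p x = c_transform D c f p x"
  shows "\<And>w. w \<in> vec_prod D \<Longrightarrow> (\<Sum>k\<in>UNIV. f k (w $ k)) \<le> c w"
    and "\<And>x. x \<in> D p \<Longrightarrow> \<exists>w\<in>contact_set D c f. w $ p = x"
proof -
  define h where "h = (\<lambda>w. c w - (\<Sum>k\<in>UNIV. f k (w $ k)))"
  have conth: "continuous_on (vec_prod D) h"
    unfolding h_def using continuous_on_vec_prod_sum[of D f, OF f] c by (intro continuous_on_diff)
  define F where "F x = {w \<in> vec_prod D. w $ p = x}" for x
  have key: "(\<forall>w\<in>F x. 0 \<le> h w) \<and> (\<exists>w\<in>F x. h w = 0)" if x: "x \<in> D p" for x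
  proof -
    have "closed {w :: (real^'n)^'k. w $ p = x}"
      by (intro closed_Collect_eq continuous_intros)
    then have "compact (vec_prod D \<inter> {w :: (real^'n)^'k. w $ p = x})"
      by (rule compact_Int_closed[OF compact_vec_prod[of D, OF K(1)]])
    moreover have "F x = vec_prod D \<inter> {w :: (real^'n)^'k. w $ p = x}" by (auto simp: F_def)
    ultimately have cF: "compact (F x)" by simp
    have "\<exists>z. \<forall>j. z j \<in> D j" using K(2) by (meson ex_in_conv)
    then obtain z where z: "\<And>j. z j \<in> D j" by blast
    have "insert_at p x z \<in> F x"
      using z x by (auto simp: F_def vec_prod_def insert_at_def)
    then have "F x \<noteq> {}" by blast
    moreover have "continuous_on (F x) h" using conth by (rule continuous_on_subset) (auto simp: F_def)
    ultimately obtain w0 where w0: "w0 \<in> F x" "\<And>w. w \<in> F x \<Longrightarrow> h w0 \<le> h w"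
      using continuous_attains_inf[OF cF] by blast
    have val: "c (insert_at p x z) - (\<Sum>k\<in>- {p}. f k (z k)) = h (insert_at p x z) + f p x" for z
      by (simp add: h_def sum_insert_at)
    have "c_transform D c f p x = h w0 + f p x"
      unfolding c_transform_def val
    proof (rule cInf_eq_minimum)
      have "w0 = insert_at p x (restrict (($) w0) (- {p}))"
        using w0(1) insert_at_restrict[of p w0] by (simp add: F_def)
      then show "h w0 + f p x \<in> (\<lambda>z. h (insert_at p x z) + f p x) ` others D p"
        using w0(1) restrict_in_others[of w0 D p]
        by (intro image_eqI[of _ _ "restrict (($) w0) (- {p})"]) (simp_all add: F_def)
      show "h w0 + f p x \<le> y" if "y \<in> (\<lambda>z. h (insert_at p x z) + f p x) ` others D p" for y
        using that w0(2) insert_at_in_vec_prod[of x D p] x by (auto simp: F_def)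
    qed
    then have "h w0 = 0" using conj[OF x] by simp
    with w0 show ?thesis by metis
  qed
  show "(\<Sum>k\<in>UNIV. f k (w $ k)) \<le> c w" if "w \<in> vec_prod D" for w
  proof -
    have "w $ p \<in> D p" "w \<in> F (w $ p)" using that by (auto simp: F_def vec_prod_def)
    then show ?thesis using key by (force simp: h_def)
  qed
  show "\<exists>w\<in>contact_set D c f. w $ p = x" if "x \<in> D p" for x
    using key[OF that] by (force simp: h_def F_def contact_set_def)
qed

section \<open>Two contact points over one base point force a kink\<close>

text \<open>
  If only component \<open>p\<close> of a contact tuple moves, then the sum of the potentials changes just by
  the increment of \<open>f p\<close>. The sum starts equal to \<open>c\<close> and stays below it, so the increment of \<open>c\<close>
  dominates that of \<open>f p\<close>.
\<close>

lemma contact_slope_less: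
  fixes D :: "'k::finite \<Rightarrow> (real^'n) set"
  assumes D: "\<And>j. compact (D j)" "\<And>j. D j \<subseteq> closure (interior (D j))"
    and C1: "C1_with_gradient (vec_prod D) c G"
    and below: "\<And>w. w \<in> vec_prod D \<Longrightarrow> (\<Sum>k\<in>UNIV. f k (w $ k)) \<le> c w"
    and w: "w \<in> contact_set D c f" "w $ p \<in> interior (D p)"
    and slope: "G w $ p \<bullet> v < q"
  shows "\<exists>d>0. \<forall>s. 0 < s \<and> s < d \<longrightarrow> f p (w $ p + s *\<^sub>R v) - f p (w $ p) < q * s"
proof -
  define W where "W = vec_prod (\<lambda>i. interior (D i))"
  define u where "u = (\<chi> i. if i = p then v else 0)"
  have W: "open W" "W \<subseteq> vec_prod D" "w \<in> closure W"
  proof -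
    show "open W" unfolding W_def vec_prod_def by (intro open_vector_box) auto
    show "W \<subseteq> vec_prod D" using interior_subset by (auto simp: W_def vec_prod_def)
    show "w \<in> closure W"
      using w(1) vec_prod_subset_closure_interiors[of D, OF D(2)] by (auto simp: W_def contact_set_def)
  qed
  obtain e where e: "e > 0" "ball (w $ p) e \<subseteq> interior (D p)"
    using w(2) open_interior open_contains_ball by blast
  \<comment> \<open>Makes \<open>r + r * norm v = e\<close>: start point and step together stay in the ball.\<close>
  define r where "r = e / (norm v + 1)"
  have r: "r > 0" using e by (simp add: r_def add_nonneg_pos)
  have stay: "y + s *\<^sub>R u \<in> W" if y: "y \<in> W" "dist y w < r" "0 \<le> s" "s < r" for y s
  proof -
    have "dist (y $ p + s *\<^sub>R v) (w $ p) \<le> dist (y $ p) (w $ p) + s * norm v"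
      using y(3) norm_triangle_ineq[of "y $ p - w $ p" "s *\<^sub>R v"] by (simp add: dist_norm algebra_simps)
    also have "\<dots> < r + r * norm v"
      using y dist_vec_nth_le[of y p w] by (intro add_less_le_mono mult_right_mono) auto
    also have "\<dots> = e"
    proof -
      have "norm v + 1 \<noteq> 0" using norm_ge_zero[of v] by linarith
      then have "r * (norm v + 1) = e" by (simp add: r_def)
      then show ?thesis by (simp add: algebra_simps)
    qed
    finally have "y $ p + s *\<^sub>R v \<in> interior (D p)" using e(2) by (auto simp: dist_commute)
    then show ?thesis using y(1) by (auto simp: W_def vec_prod_def u_def)
  qed
  have "G w \<bullet> u = (\<Sum>i\<in>UNIV. if i = p then G w $ p \<bullet> v else 0)"
    unfolding inner_vec_def[of "G w"] by (intro sum.cong) (auto simp: u_def)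
  then have "G w \<bullet> u = G w $ p \<bullet> v" by simp
  then have "\<exists>d>0. \<forall>s. 0 < s \<and> s < d \<longrightarrow>
      w + s *\<^sub>R u \<in> vec_prod D \<and> c (w + s *\<^sub>R u) - c w < q * s"
    using C1_with_gradient_slope_less[OF C1 _ W r stay] slope
      compact_imp_closed[OF compact_vec_prod[of D, OF D(1)]] by simp
  moreover have "f p (w $ p + s *\<^sub>R v) - f p (w $ p) \<le> c (w + s *\<^sub>R u) - c w"
    if "w + s *\<^sub>R u \<in> vec_prod D" for s
  proof -
    have "(\<Sum>k\<in>UNIV. f k ((w + s *\<^sub>R u) $ k)) - (\<Sum>k\<in>UNIV. f k (w $ k)) =
       (\<Sum>k\<in>UNIV. if k = p then f p (w $ p + s *\<^sub>R v) - f p (w $ p) else 0)"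
      unfolding sum_subtractf[symmetric] by (intro sum.cong) (auto simp: u_def)
    also have "\<dots> = f p (w $ p + s *\<^sub>R v) - f p (w $ p)" by simp
    finally show ?thesis
      using below[OF that] w(1) by (simp add: contact_set_def)
  qed
  ultimately show ?thesis by (meson le_less_trans)
qed

text \<open>
  The contact tuple with the smaller slope bounds \<open>f p\<close> in direction \<open>v\<close>. The one with the larger
  slope bounds it in direction \<open>- v\<close>, where its slope is the smaller one.
\<close>

lemma contact_kink_strict_local_max:
  fixes D :: "'k::finite \<Rightarrow> (real^'n) set"
  assumes D: "\<And>j. compact (D j)" "\<And>j. D j \<subseteq> closure (interior (D j))"
    and C1: "C1_with_gradient (vec_prod D) c G"
    and below: "\<And>w. w \<in> vec_prod D \<Longrightarrow> (\<Sum>k\<in>UNIV. f k (w $ k)) \<le> c w"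
    and w: "w \<in> contact_set D c f" "w $ p = x + t *\<^sub>R v"
    and w': "w' \<in> contact_set D c f" "w' $ p = x + t *\<^sub>R v"
    and int: "x + t *\<^sub>R v \<in> interior (D p)"
    and slopes: "G w $ p \<bullet> v < q" "q < G w' $ p \<bullet> v"
  shows "\<exists>V. open V \<and> t \<in> V \<and>
    (\<forall>s\<in>V - {t}. f p (x + s *\<^sub>R v) - q * s < f p (x + t *\<^sub>R v) - q * t)"
proof -
  obtain d1 where d1: "d1 > 0" "\<And>s. 0 < s \<Longrightarrow> s < d1 \<Longrightarrow>
      f p (x + t *\<^sub>R v + s *\<^sub>R v) - f p (x + t *\<^sub>R v) < q * s"
    using contact_slope_less[OF D C1 below, of w p v q] w int slopes by auto
  obtain d2 where d2: "d2 > 0" "\<And>s. 0 < s \<Longrightarrow> s < d2 \<Longrightarrow>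
      f p (x + t *\<^sub>R v + s *\<^sub>R (- v)) - f p (x + t *\<^sub>R v) < (- q) * s"
    using contact_slope_less[OF D C1 below, of w' p "- v" "- q"] w' int slopes by auto
  have "f p (x + s *\<^sub>R v) - q * s < f p (x + t *\<^sub>R v) - q * t"
    if s: "s \<in> ball t (min d1 d2) - {t}" for s
  proof (cases "s > t")
    case True
    then have "f p (x + t *\<^sub>R v + (s - t) *\<^sub>R v) - f p (x + t *\<^sub>R v) < q * (s - t)"
      using s by (intro d1(2)) (auto simp: dist_real_def)
    then show ?thesis by (simp add: algebra_simps)
  next
    case False
    then have "f p (x + t *\<^sub>R v + (t - s) *\<^sub>R (- v)) - f p (x + t *\<^sub>R v) < (- q) * (t - s)"
      using s by (intro d2(2)) (auto simp: dist_real_def)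
    then show ?thesis by (simp add: algebra_simps)
  qed
  then show ?thesis using d1(1) d2(1) by (intro exI[of _ "ball t (min d1 d2)"]) auto
qed

text \<open>
  The closed lower bound \<open>1 / Suc m\<close> on the gap keeps the set of pairs of tuples compact, and with it
  its projection, for compact \<open>K\<close> and continuous \<open>G\<close>; the condition that the slopes differ need not
  be closed.
\<close>

definition slope_gap_set ::
    "((real^'n)^'k::finite) set \<Rightarrow> ((real^'n)^'k \<Rightarrow> (real^'n)^'k) \<Rightarrow> 'k \<Rightarrow> real^'n \<Rightarrow> nat \<Rightarrow> (real^'n) set" where
  "slope_gap_set K G p v m =
     {x. \<exists>w\<in>K. \<exists>w'\<in>K. w $ p = x \<and> w' $ p = x \<and> G w $ p \<bullet> v + 1 / Suc m \<le> G w' $ p \<bullet> v}"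

lemma compact_slope_gap_set:
  assumes K: "compact K" and G: "continuous_on K G"
  shows "compact (slope_gap_set K G p v m)"
proof -
  define P where "P = {y \<in> K \<times> K.
    (fst y $ p - snd y $ p, G (snd y) $ p \<bullet> v - G (fst y) $ p \<bullet> v) \<in> {0} \<times> {1 / Suc m..}}"
  have KK: "compact (K \<times> K)" using K by (intro compact_Times)
  have "continuous_on (K \<times> K) (\<lambda>y. G (fst y))" "continuous_on (K \<times> K) (\<lambda>y. G (snd y))"
    by (rule continuous_on_compose2[OF G], auto intro!: continuous_intros)+
  then have "closed P"
    unfolding P_def
    by (intro continuous_closed_preimage[unfolded vimage_def Int_def mem_Collect_eq]
        continuous_intros compact_imp_closed[OF KK] closed_Times) auto
  then have "compact P"
    using compact_Int_closed[OF KK, of P] by (simp add: P_def Int_def conj_left_absorb cong: conj_cong)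
  then have "compact ((\<lambda>y. fst y $ p) ` P)"
    by (intro compact_continuous_image continuous_intros)
  moreover have "(\<lambda>y. fst y $ p) ` P = slope_gap_set K G p v m"
    by (force simp: P_def slope_gap_set_def image_iff algebra_simps)
  ultimately show ?thesis by simp
qed

text \<open>
  On a line in direction \<open>v\<close>, each point of the set is a strict local maximum of \<open>f p\<close> minus a linear
  function of rational slope, so the line meets the set in countably many points.
\<close>

lemma slope_gap_set_null:
  fixes D :: "'k::finite \<Rightarrow> (real^'n) set"
  assumes D: "\<And>j. compact (D j)" "\<And>j. D j \<subseteq> closure (interior (D j))"
    and C1: "C1_with_gradient (vec_prod D) c G" and f: "\<And>j. continuous_on (D j) (f j)"
    and below: "\<And>w. w \<in> vec_prod D \<Longrightarrow> (\<Sum>k\<in>UNIV. f k (w $ k)) \<le> c w"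
  shows "interior (D p) \<inter> slope_gap_set (contact_set D c f) G p v m \<in> null_sets lborel"
    (is "?S \<in> _")
proof (rule null_set_if_countable_on_parallel_lines)
  have "compact (slope_gap_set (contact_set D c f) G p v m)"
    using C1 D f unfolding C1_with_gradient_def
    by (intro compact_slope_gap_set compact_contact_set)
      (auto elim: continuous_on_subset simp: contact_set_def)
  then show "?S \<in> sets borel" by (intro sets.Int borel_open borel_compact) auto
next
  fix x
  define M where "M q = {t. \<exists>V. open V \<and> t \<in> V \<and>
    (\<forall>s\<in>V - {t}. f p (x + s *\<^sub>R v) - q * s < f p (x + t *\<^sub>R v) - q * t)}" for q :: real
  have "{t. x + t *\<^sub>R v \<in> ?S} \<subseteq> (\<Union>q\<in>\<rat>. M q)"
  proof
    fix t assume "t \<in> {t. x + t *\<^sub>R v \<in> ?S}"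
    then obtain w w' where w: "w \<in> contact_set D c f" "w' \<in> contact_set D c f"
        "w $ p = x + t *\<^sub>R v" "w' $ p = x + t *\<^sub>R v" "x + t *\<^sub>R v \<in> interior (D p)"
        "G w $ p \<bullet> v + 1 / Suc m \<le> G w' $ p \<bullet> v"
      by (auto simp: slope_gap_set_def)
    have "0 < 1 / real (Suc m)" by simp
    with w(6) have "G w $ p \<bullet> v < G w' $ p \<bullet> v" by linarith
    then obtain q where "q \<in> \<rat>" "G w $ p \<bullet> v < q" "q < G w' $ p \<bullet> v"
      using Rats_dense_in_real by blast
    moreover from this have "t \<in> M q"
      using contact_kink_strict_local_max[OF D C1 below, of w p x t v w' q] w by (simp add: M_def)
    ultimately show "t \<in> (\<Union>q\<in>\<rat>. M q)" by blast
  qed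
  moreover have "countable (\<Union>q\<in>\<rat>. M q)"
    unfolding M_def
    by (intro countable_UN countable_strict_local_maxima countable_rat)
  ultimately show "countable {t. x + t *\<^sub>R v \<in> ?S}" by (rule countable_subset)
qed

section \<open>Almost everywhere single-valuedness\<close>

theorem proposition2p9:
  fixes D :: "'k::finite \<Rightarrow> (real^'n) set"
    and c :: "(real^'n)^'k \<Rightarrow> real"
    and G :: "(real^'n)^'k \<Rightarrow> (real^'n)^'k"
    and p :: 'k
  assumes "CARD('k) \<ge> 2"
    and "\<And>j. compact_domain (D j)"
    and "frontier (D p) \<in> null_sets lebesgue"
    and "C1_with_gradient (vec_prod D) c G"
    and "lipschitz_cost D c"
    and "\<And>x. x \<in> D p \<Longrightarrow> inj_on (\<lambda>z. G (insert_at p x z) $ p) (others D p)"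
  shows "single_valued_ae D c p"
  unfolding single_valued_ae_def
proof (intro allI impI, elim conjE)
  fix f assume f: "\<forall>j. continuous_on (D j) (f j)" and conj: "c_conjugate D c f"
  note D = compact_domainD[OF assms(2)]
  have D3: "D j \<subseteq> closure (interior (D j))" for j using D(3)[of j] by blast
  have c: "continuous_on (vec_prod D) c" using assms(4) by (simp add: C1_with_gradient_def)
  have conj': "f p x = c_transform D c f p x" if "x \<in> D p" for x
    using conj that by (simp add: c_conjugate_def)
  have below: "(\<Sum>k\<in>UNIV. f k (w $ k)) \<le> c w" if "w \<in> vec_prod D" for w
    using c_transform_contact(1)[OF D(1,2) c _ conj' that] f by blast
  have attained: "\<exists>w\<in>contact_set D c f. w $ p = x" if "x \<in> D p" for x
    using c_transform_contact(2)[OF D(1,2) c _ conj' that] f by blast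
  define bad where
    "bad v m = interior (D p) \<inter> slope_gap_set (contact_set D c f) G p v m" for v m
  define N where "N = frontier (D p) \<union> (\<Union>v\<in>Basis. \<Union>m. bad v m)"
  have "bad v m \<in> null_sets lebesgue" for v m
    unfolding bad_def
    using slope_gap_set_null[OF D(1) D3 assms(4) f[rule_format] below, where p = p]
    by (intro null_sets_completionI) auto
  then have "N \<in> null_sets lebesgue"
    unfolding N_def using assms(3)
    by (intro null_sets.Un null_sets_UN' null_sets_UN) (auto intro: countable_finite)
  then have "AE x in lebesgue. x \<notin> N" by (rule AE_not_in)
  then show "AE x in lebesgue. x \<in> D p \<longrightarrow> is_singleton (c_normal D c p f x)"
  proof (eventually_elim, intro impI)
    fix x assume xN: "x \<notin> N" and x: "x \<in> D p"
    have int: "x \<in> interior (D p)"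
      using xN x closure_subset by (auto simp: N_def frontier_def)
    obtain w where w: "w \<in> contact_set D c f" "w $ p = x" using attained[OF x] by blast
    define z where "z = restrict (($) w) (- {p})"
    have "insert_at p x z = w" using w(2) by (auto simp: z_def)
    moreover have "z \<in> others D p"
      using w(1) restrict_in_others by (auto simp: z_def contact_set_def)
    ultimately have z: "z \<in> c_normal D c p f x"
      using w(1) c_normal_iff_contact[of x D p, OF x] by auto
    \<comment> \<open>Symmetric in \<open>a\<close> and \<open>b\<close>, so the slopes agree in each coordinate direction.\<close>
    have le: "G (insert_at p x a) $ p \<bullet> v \<le> G (insert_at p x b) $ p \<bullet> v"
      if ab: "a \<in> c_normal D c p f x" "b \<in> c_normal D c p f x" and v: "v \<in> Basis" for a b v
    proof (rule ccontr)
      assume "\<not> ?thesis"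
      then obtain m where
        "inverse (real (Suc m)) < G (insert_at p x a) $ p \<bullet> v - G (insert_at p x b) $ p \<bullet> v"
        using reals_Archimedean[of "G (insert_at p x a) $ p \<bullet> v - G (insert_at p x b) $ p \<bullet> v"]
        by auto
      then have "G (insert_at p x b) $ p \<bullet> v + 1 / Suc m \<le> G (insert_at p x a) $ p \<bullet> v"
        by (simp add: inverse_eq_divide)
      then have "x \<in> bad v m"
        unfolding bad_def slope_gap_set_def
        using int ab c_normal_iff_contact[of x D p, OF x] by (auto intro!: bexI)
      with xN v show False by (auto simp: N_def)
    qed
    have "b = z" if b: "b \<in> c_normal D c p f x" for b
    proof -
      have "G (insert_at p x b) $ p = G (insert_at p x z) $ p"
        using le[OF b z] le[OF z b] by (metis euclidean_eqI order_antisym)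
      then show ?thesis
        using assms(6)[OF x] b z c_normal_iff_contact[of x D p, OF x] by (auto dest: inj_onD)
    qed
    with z have "c_normal D c p f x = {z}" by blast
    then show "is_singleton (c_normal D c p f x)" by (simp add: is_singleton_def)
  qed
qed

end
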